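(* Let $h$ and $F$ be as in the context, and suppose: $\nabla F$ is $L_{\nabla F}$-Lipschitz; $h$ is $(\alpha,\beta)$-regular (smooth sense) for $F$ with unique minimizer $z^\star$ over $\operatorname{Im}F$; and $F$ is weakly aligned at $z^\star$ with functions $\delta,s$. Let $x_0\in\mathbf{E}$ be such that $z_0=F(x_0)$ satisfies $\|z_0-z^\star\|\le \delta\left(\frac{\alpha}{16\beta}\right)$. Then the following two statements hold. 1. (Polyak stepsize) Suppose $(x_k)_{k\ge0}$ is generated by the LMM method started at $x_0$ with the Polyak configuration with parameters $\gamma, C_{\mathtt{lb}}, C_{\mathtt{ub}}$, where $\gamma\le\min\left\{1,\frac{C_{\mathtt{lb}}}{L_{\nabla F}}\right\}$ and $C_{\mathtt{ub}}\le\frac{\alpha}{16\beta}\,s\left(\frac{\alpha}{16\beta}\right)$. Then $z_k=F(x_k)$ satisfies $$\|z_k-z^\star\|^2\le\left(1-\frac{\gamma\alpha}{32\beta}\right)^{k}\|z_0-z^\star\|^2\quad\text{for all }k\ge0.$$ 2. (Constant stepsize) Let $M=\delta\left(\frac{\alpha}{16\beta}\right)$. Suppose $(x_k)_{k\ge0}$ is generated by the LMM method started at $x_0$ with $\gamma_k=\gamma$, $\lambda_k=\lambda q^k$, where $\gamma,\lambda>0$, $q\in(0,1)$ satisfy $$\lambda\le\frac{M\,s\left(\frac{\alpha}{16\beta}\right)}{64}\frac{\alpha}{\beta},\qquad \gamma\le\frac1\beta\min\left\{\frac18,\sqrt{\frac{32\lambda}{L_{\nabla F}M}},\frac{\lambda}{2L_{\nabla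 F}M}\right\},\qquad q\ge\max\left\{\sqrt{1-\frac{\gamma\alpha}{2}},\frac1{\sqrt2}\right\}.$$ Then $z_k=F(x_k)$ satisfies $\|z_k-z^\star\|\le Mq^k$ for all $k\ge0$.
   Context: Setting. $\mathbf{E},\mathbf{Y}$ are finite-dimensional Euclidean spaces with inner products $\langle\cdot,\cdot\rangle$ and induced norms $\|\cdot\|$; $h:\mathbf{Y}\to\mathbb{R}$ is convex and differentiable, and $F:\mathbf{E}\to\mathbf{Y}$ is continuously differentiable. $\nabla F(x):\mathbf{E}\to\mathbf{Y}$ is the derivative (Jacobian) and $\nabla F(x)^\top$ its adjoint. $\mathbb{R}_+$ denotes the positive reals, $B_r(z)$ the closed ball of radius $r$, and $1/0=+\infty$. $h^\star$ and $\mathcal{Z}^\star$ are the minimum value and the set of minimizers of $h$ over $\operatorname{Im}F$. $\Pi^x$ is the orthogonal projection onto the range of $\nabla F(x)$. Fix for each $x$ an SVD of $\nabla F(x)$ with singular values $\sigma^x_1\ge\sigma^x_2\ge\cdots$; $\Pi^x_j$ is the orthogonal projection onto the span of the top $j$ left singular vectors. For $\lambda>0$, $P(x,\lambda)=\nabla F(x)(\nabla F(x)^\top\nabla F(x)+\lambda I)^{-1}\nabla F(x)^\top$. LMM (Levenberg-Morrison-Marquardt) method. Given $x_0\in\mathbf{E}$, stepsizes $\gamma_k>0$ and damping coefficients $\lambda_k>0$: for $k\ge0$ let $v_k=\nabla h(F(x_k))$ and set $x_{k+1}=x_k-\gamma_k(\nabla F(x_k)^\top\nabla F(x_k)+\lambda_kI)^{-1}\nabla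 F(x_k)^\top v_k$. Write $z_k=F(x_k)$. Polyak configuration with parameters $\gamma>0$, $0<C_{\mathtt{lb}}\le C_{\mathtt{ub}}$: $\gamma_k=\gamma\frac{h(z_k)-h^\star}{\|\Pi^{x_k}v_k\|^2}$ and $C_{\mathtt{lb}}\operatorname{dist}(z_k,\mathcal{Z}^\star)\le\lambda_k\le C_{\mathtt{ub}}\operatorname{dist}(z_k,\mathcal{Z}^\star)$ for all $k$. $\nabla F$ is $L_{\nabla F}$-Lipschitz ($L_{\nabla F}\ge0$): $\|\nabla F(x)-\nabla F(y)\|_{\mathrm{op}}\le L_{\nabla F}\|x-y\|$ for all $x,y\in\mathbf{E}$. $F$ is weakly aligned at $z^\star\in\operatorname{Im}F$ with functions $\delta,s:\mathbb{R}_+\to\mathbb{R}_+$: for any $\rho>0$ and any $z=F(x)\in B_{\delta(\rho)}(z^\star)$ there is an index $j$ with $\|(I-\Pi^x_j)(z-z^\star)\|\le\rho\|z-z^\star\|$ and $(\sigma^x_j)^2\ge s(\rho)\|z-z^\star\|$. $h$ is $(\alpha,\beta)$-regular (smooth sense) for $F$ ($\alpha,\beta>0$): (1) $h$ has a unique minimizer $z^\star$ over $\operatorname{Im}F$; (2) $h$ is convex; (3) $h(z)-h^\star\ge\frac{\alpha}{2}\|z-z^\star\|^2$ for all $z\in\operatorname{Im}F$; (4a) for all $x\in\mathbf{E}$ and $z=F(x)$, $\|\Pi^x\nabla h(z)\|\le\beta\|z-z^\star\|$ and $h(z)-h^\star\ge\frac1{2\beta}\|\Pi^x\nabla h(z)\|^2$;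 (4b) for all $x\in\mathbf{E}$, $z=F(x)$, $\lambda>0$, $|\langle\nabla h(z),(I-P(x,\lambda))(z-z^\star)\rangle|\le\beta\|z-z^\star\|\,\|(I-P(x,\lambda))(z-z^\star)\|$. *)

theory Defs
  imports "HOL-Analysis.Analysis"
begin

definition minimizers :: "('b \<Rightarrow> real) \<Rightarrow> ('a \<Rightarrow> 'b) \<Rightarrow> 'b set" where
  "minimizers h F = {z. is_arg_min h (\<lambda>w. w \<in> range F) z}"

definition min_value :: "('b \<Rightarrow> real) \<Rightarrow> ('a \<Rightarrow> 'b) \<Rightarrow> real" where
  "min_value h F = (INF w\<in>range F. h w)"

definition orth_proj :: "'b::euclidean_space set \<Rightarrow> 'b \<Rightarrow> 'b" where
  "orth_proj S y = (THE p. p \<in> S \<and> y - p \<in> orthogonal_comp S)"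

text \<open>Every linear subspace of a Euclidean space has an orthogonal projection, so the
  description above is proper.\<close>

lemma orth_proj_ex1:
  fixes S :: "'b::euclidean_space set"
  assumes "subspace S"
  shows "\<exists>!p. p \<in> S \<and> y - p \<in> orthogonal_comp S"
proof -
  obtain p q where pq: "p \<in> span S" "\<And>w. w \<in> span S \<Longrightarrow> orthogonal q w" "y = p + q"
    using orthogonal_subspace_decomp_exists[of S y] by blast
  have sp: "span S = S" using assms by (simp add: span_eq_iff)
  show ?thesis
  proof (rule ex1I[of _ p])
    show "p \<in> S \<and> y - p \<in> orthogonal_comp S"
      using pq sp by (auto simp: orthogonal_comp_def orthogonal_commute)
  next
    fix p' assume p': "p' \<in> S \<and> y - p' \<in> orthogonal_comp S"
    have d: "p - p' \<in> S" using p' pq sp assms by (auto intro: subspace_diff)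
    have "(y - p') \<bullet> (p - p') = 0"
      using p' d by (auto simp: orthogonal_comp_def orthogonal_def inner_commute)
    moreover have "(y - p) \<bullet> (p - p') = 0"
      using d pq sp by (simp add: orthogonal_def)
    ultimately have "(p - p') \<bullet> (p - p') = 0" by (simp add: inner_diff_left)
    thus "p' = p" by simp
  qed
qed

text \<open>The inverse of \<open>A\<^sup>T A + \<lambda> I\<close>.\<close>

definition damped_inv ::
  "('a::euclidean_space \<Rightarrow>\<^sub>L 'b::euclidean_space) \<Rightarrow> real \<Rightarrow> 'a \<Rightarrow> 'a" where
  "damped_inv A lam = inv (\<lambda>w. adjoint A (A w) + lam *\<^sub>R w)"

lemma damped_bij:
  fixes A :: "'a::euclidean_space \<Rightarrow>\<^sub>L 'b::euclidean_space"
  assumes "lam > 0"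
  shows "bij (\<lambda>w. adjoint A (A w) + lam *\<^sub>R w)"
proof -
  let ?T = "\<lambda>w. adjoint A (A w) + lam *\<^sub>R w"
  have lA: "linear (blinfun_apply A)" by (simp add: blinfun.bounded_linear_right bounded_linear.linear)
  have lin: "linear ?T"
    using linear_compose[OF lA adjoint_linear[OF lA]]
    by (intro linear_compose_add linear_compose_scale_right linear_ident) (simp add: o_def)
  have "inj ?T"
  proof (subst linear_injective_0[OF lin], intro allI impI)
    fix w assume "?T w = 0"
    hence "w \<bullet> ?T w = 0" by simp
    hence "A w \<bullet> A w + lam * (w \<bullet> w) = 0"
      by (simp add: inner_add_right adjoint_works[OF lA])
    moreover have "A w \<bullet> A w \<ge> 0" "w \<bullet> w \<ge> 0" by auto
    ultimately have "lam * (w \<bullet> w) = 0"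
      using assms by (smt (verit) mult_nonneg_nonneg)
    thus "w = 0" using assms by simp
  qed
  thus ?thesis using linear_injective_imp_surjective[OF lin] by (simp add: bij_def)
qed

definition damped_proj ::
  "('a::euclidean_space \<Rightarrow>\<^sub>L 'b::euclidean_space) \<Rightarrow> real \<Rightarrow> 'b \<Rightarrow> 'b" where
  "damped_proj A lam y = A (damped_inv A lam (adjoint A y))"

text \<open>Singular values and vectors are indexed from 1; values of \<open>sig\<close>, \<open>u\<close>, \<open>v\<close> at
  indices outside \<open>{1..min (dim E) (dim Y)}\<close> are irrelevant. As for matrices, zero singular
  values are included.\<close>

definition is_svd ::
  "('a::euclidean_space \<Rightarrow>\<^sub>L 'b::euclidean_space) \<Rightarrow> (nat \<Rightarrow> real) \<Rightarrow> (nat \<Rightarrow> 'b) \<Rightarrow> (nat \<Rightarrow> 'a) \<Rightarrow> bool"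
  where
  "is_svd A sig u v \<longleftrightarrow>
    (let r = min DIM('a) DIM('b) in
      (\<forall>i\<in>{1..r}. \<forall>j\<in>{1..r}. u i \<bullet> u j = (if i = j then 1 else 0)) \<and>
      (\<forall>i\<in>{1..r}. \<forall>j\<in>{1..r}. v i \<bullet> v j = (if i = j then 1 else 0)) \<and>
      (\<forall>i\<in>{1..r}. 0 \<le> sig i) \<and> antimono_on {1..r} sig \<and>
      (\<forall>w. A w = (\<Sum>i=1..r. (sig i * (v i \<bullet> w)) *\<^sub>R u i)))"

text \<open>Below, \<open>DF x\<close> is the derivative of \<open>F\<close> at \<open>x\<close>, \<open>gradh z\<close> the gradient of \<open>h\<close> at \<open>z\<close>, and
  \<open>sig x\<close>, \<open>u x\<close> are the singular values and left singular vectors of \<open>DF x\<close> in the chosen SVD.\<close>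

definition weakly_aligned ::
  "('a::euclidean_space \<Rightarrow> 'b::euclidean_space) \<Rightarrow> ('a \<Rightarrow> nat \<Rightarrow> real) \<Rightarrow> ('a \<Rightarrow> nat \<Rightarrow> 'b)
    \<Rightarrow> 'b \<Rightarrow> (real \<Rightarrow> real) \<Rightarrow> (real \<Rightarrow> real) \<Rightarrow> bool" where
  "weakly_aligned F sig u zs \<delta> s \<longleftrightarrow>
    zs \<in> range F \<and> (\<forall>\<rho>>0. \<delta> \<rho> > 0 \<and> s \<rho> > 0) \<and>
    (\<forall>\<rho>>0. \<forall>x. F x \<in> cball zs (\<delta> \<rho>) \<longrightarrow>
      (\<exists>j\<in>{1..min DIM('a) DIM('b)}.
        norm ((F x - zs) - orth_proj (span (u x ` {1..j})) (F x - zs)) \<le> \<rho> * norm (F x - zs) \<and>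
        (sig x j)\<^sup>2 \<ge> s \<rho> * norm (F x - zs)))"

definition smooth_regular ::
  "('b::euclidean_space \<Rightarrow> real) \<Rightarrow> ('b \<Rightarrow> 'b) \<Rightarrow> ('a::euclidean_space \<Rightarrow> 'b) \<Rightarrow> ('a \<Rightarrow> 'a \<Rightarrow>\<^sub>L 'b)
    \<Rightarrow> real \<Rightarrow> real \<Rightarrow> 'b \<Rightarrow> bool" where
  "smooth_regular h gradh F DF \<alpha> \<beta> zs \<longleftrightarrow>
    \<alpha> > 0 \<and> \<beta> > 0 \<and>
    minimizers h F = {zs} \<and>
    convex_on UNIV h \<and>
    (\<forall>z\<in>range F. h z - min_value h F \<ge> \<alpha> / 2 * (norm (z - zs))\<^sup>2) \<and>
    (\<forall>x. norm (orth_proj (range (DF x)) (gradh (F x))) \<le> \<beta> * norm (F x - zs) \<and>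
      h (F x) - min_value h F \<ge> 1 / (2 * \<beta>) * (norm (orth_proj (range (DF x)) (gradh (F x))))\<^sup>2) \<and>
    (\<forall>x. \<forall>lam>0.
      \<bar>gradh (F x) \<bullet> ((F x - zs) - damped_proj (DF x) lam (F x - zs))\<bar>
        \<le> \<beta> * norm (F x - zs) * norm ((F x - zs) - damped_proj (DF x) lam (F x - zs)))"

definition lmm ::
  "('b::euclidean_space \<Rightarrow> 'b) \<Rightarrow> ('a::euclidean_space \<Rightarrow> 'b) \<Rightarrow> ('a \<Rightarrow> 'a \<Rightarrow>\<^sub>L 'b) \<Rightarrow> 'a
    \<Rightarrow> (nat \<Rightarrow> real) \<Rightarrow> (nat \<Rightarrow> real) \<Rightarrow> (nat \<Rightarrow> 'a) \<Rightarrow> bool" where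
  "lmm gradh F DF x0 gam lam x \<longleftrightarrow>
    x 0 = x0 \<and>
    (\<forall>k. gam k > 0 \<and> lam k > 0 \<and>
      x (Suc k) = x k -
        gam k *\<^sub>R damped_inv (DF (x k)) (lam k) (adjoint (DF (x k)) (gradh (F (x k)))))"

definition polyak ::
  "('b::euclidean_space \<Rightarrow> real) \<Rightarrow> ('b \<Rightarrow> 'b) \<Rightarrow> ('a::euclidean_space \<Rightarrow> 'b) \<Rightarrow> ('a \<Rightarrow> 'a \<Rightarrow>\<^sub>L 'b)
    \<Rightarrow> real \<Rightarrow> real \<Rightarrow> real \<Rightarrow> (nat \<Rightarrow> real) \<Rightarrow> (nat \<Rightarrow> real) \<Rightarrow> (nat \<Rightarrow> 'a) \<Rightarrow> bool" where
  "polyak h gradh F DF \<gamma> Clb Cub gam lam x \<longleftrightarrow>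
    \<gamma> > 0 \<and> 0 < Clb \<and> Clb \<le> Cub \<and>
    (\<forall>k. gam k = \<gamma> * ((h (F (x k)) - min_value h F)
                  / (norm (orth_proj (range (DF (x k))) (gradh (F (x k)))))\<^sup>2) \<and>
         Clb * infdist (F (x k)) (minimizers h F) \<le> lam k \<and>
         lam k \<le> Cub * infdist (F (x k)) (minimizers h F))"

end

theory Submission
  imports Defs
begin

text \<open>
  Seen in the image of \<open>F\<close>, a step of the method is a preconditioned gradient step
  \<open>z \<mapsto> z - t P g\<close> with \<open>g = \<nabla>h(z)\<close> and \<open>P = A (A\<^sup>T A + \<lambda>)\<^sup>-\<^sup>1 A\<^sup>T\<close>, plus the second-order
  remainder of \<open>F\<close>. Put \<open>e = z - z\<^sup>\<star>\<close> and let \<open>D = h(z) - h\<^sup>\<star>\<close> be the gap.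

  If \<open>P\<close> were the identity, convexity would give the usual descent
  \<open>\<parallel>e - t g\<parallel>\<^sup>2 \<le> \<parallel>e\<parallel>\<^sup>2 - 2 t D + t\<^sup>2 \<parallel>g\<parallel>\<^sup>2\<close>. The true \<open>P\<close> costs an additional term
  \<open>\<langle>g, (I - P) e\<rangle>\<close>, which regularity bounds by \<open>\<beta> \<parallel>e\<parallel> \<parallel>(I - P) e\<parallel>\<close>
  (\<open>regular_linearized_step\<close>). Weak alignment makes this small: \<open>e\<close> lies, up to a fraction
  \<open>\<rho> = \<alpha> / (16 \<beta>)\<close>, in the span of singular vectors with \<open>\<sigma>\<^sup>2 \<ge> s(\<rho>) \<parallel>e\<parallel>\<close>, where \<open>I - P\<close> shrinks
  by \<open>\<lambda> / (\<sigma>\<^sup>2 + \<lambda>)\<close>, so that \<open>\<parallel>(I - P) e\<parallel> \<le> \<rho> \<parallel>e\<parallel> + \<lambda> / s(\<rho>)\<close>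
  (\<open>weakly_aligned_damping_error\<close>). With \<open>\<lambda>\<close> small compared with the distance to the solution,
  quadratic growth of the gap then absorbs the cost.

  The remainder pulls the other way. It is at most \<open>L t\<^sup>2 \<parallel>\<Pi> g\<parallel>\<^sup>2 / (8 \<lambda>)\<close> (\<open>lmm_step_remainder\<close>),
  and so \<open>\<lambda>\<close> must not be small compared with that distance. A \<open>\<lambda>\<close> that is proportional to
  the distance (Polyak), or to the bound \<open>M q\<^sup>k\<close> on it (constant stepsize), meets both needs. What
  is left is arithmetic for one step (\<open>polyak_step_arith\<close>, \<open>constant_step_arith\<close>) and an induction
  that keeps the iterates in the ball in which alignment holds.
\<close>

section \<open>Orthogonal and damped projections\<close>

lemma linear_blinfun: "linear (blinfun_apply A)"
  by (simp add: blinfun.bounded_linear_right bounded_linear.linear)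

lemma orth_proj_mem:
  fixes S :: "'b::euclidean_space set"
  assumes "subspace S"
  shows "orth_proj S y \<in> S"
  and "w \<in> S \<Longrightarrow> w \<bullet> (y - orth_proj S y) = 0"
proof -
  have *: "orth_proj S y \<in> S \<and> y - orth_proj S y \<in> orthogonal_comp S"
    unfolding orth_proj_def by (rule theI', rule orth_proj_ex1[OF assms])
  then show "orth_proj S y \<in> S" by blast
  show "w \<bullet> (y - orth_proj S y) = 0" if "w \<in> S"
    using * that by (auto simp: orthogonal_comp_def orthogonal_def)
qed

lemma norm_orth_proj_le:
  fixes S :: "'b::euclidean_space set"
  assumes "subspace S"
  shows "norm (orth_proj S y) \<le> norm y"
proof -
  let ?p = "orth_proj S y"
  have "?p \<bullet> (y - ?p) = 0"
    using orth_proj_mem[OF assms] by blast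
  then have "(norm y)\<^sup>2 = (norm ?p)\<^sup>2 + (norm (y - ?p))\<^sup>2"
    using norm_add_Pythagorean[of ?p "y - ?p"] by (simp add: orthogonal_def)
  then have "(norm ?p)\<^sup>2 \<le> (norm y)\<^sup>2" by simp
  then show ?thesis by (rule power2_le_imp_le) simp
qed

text \<open>This is why the step sees only the part of the gradient of \<open>h\<close> that lies in the range of
  the Jacobian, which is the part that regularity controls.\<close>

lemma adjoint_orth_proj_range:
  fixes A :: "'a::euclidean_space \<Rightarrow>\<^sub>L 'b::euclidean_space"
  shows "adjoint A (orth_proj (range A) y) = adjoint A y"
proof -
  have S: "subspace (range (blinfun_apply A))"
    by (rule linear_subspace_image[OF linear_blinfun subspace_UNIV])
  have "w \<bullet> (adjoint A y - adjoint A (orth_proj (range A) y)) = 0" for w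
    using orth_proj_mem(2)[OF S, of "A w" y]
    by (simp add: inner_diff_right adjoint_works[OF linear_blinfun])
  then show ?thesis by (metis inner_eq_zero_iff right_minus_eq)
qed

lemma damped_inv_eq:
  fixes A :: "'a::euclidean_space \<Rightarrow>\<^sub>L 'b::euclidean_space"
  assumes "lam > 0"
  shows "adjoint A (A (damped_inv A lam w)) + lam *\<^sub>R damped_inv A lam w = w"
  unfolding damped_inv_def
  using surj_f_inv_f[OF bij_is_surj[OF damped_bij[OF assms, of A]], of w] by simp

lemma damped_inv_unique:
  fixes A :: "'a::euclidean_space \<Rightarrow>\<^sub>L 'b::euclidean_space"
  assumes "lam > 0" "adjoint A (A d) + lam *\<^sub>R d = w"
  shows "damped_inv A lam w = d"
  unfolding damped_inv_def
  using inv_f_f[OF bij_is_inj[OF damped_bij[OF assms(1), of A]], of d] assms(2) by simp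

lemma linear_damped_inv:
  fixes A :: "'a::euclidean_space \<Rightarrow>\<^sub>L 'b::euclidean_space"
  assumes "lam > 0"
  shows "linear (damped_inv A lam)"
proof -
  note la = adjoint_linear[OF linear_blinfun[of A]]
  show ?thesis
  proof (rule linearI)
    fix w w' :: 'a and c :: real
    have "adjoint A (A (damped_inv A lam w + damped_inv A lam w'))
        + lam *\<^sub>R (damped_inv A lam w + damped_inv A lam w')
      = (adjoint A (A (damped_inv A lam w)) + lam *\<^sub>R damped_inv A lam w)
        + (adjoint A (A (damped_inv A lam w')) + lam *\<^sub>R damped_inv A lam w')"
      by (simp add: blinfun.add_right linear_add[OF la] scaleR_add_right)
    then show "damped_inv A lam (w + w') = damped_inv A lam w + damped_inv A lam w'"
      by (intro damped_inv_unique[OF assms]) (simp only: damped_inv_eq[OF assms])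
    have "adjoint A (A (c *\<^sub>R damped_inv A lam w)) + lam *\<^sub>R (c *\<^sub>R damped_inv A lam w)
      = c *\<^sub>R (adjoint A (A (damped_inv A lam w)) + lam *\<^sub>R damped_inv A lam w)"
      by (simp add: blinfun.scaleR_right linear_cmul[OF la] scaleR_add_right)
    then show "damped_inv A lam (c *\<^sub>R w) = c *\<^sub>R damped_inv A lam w"
      by (intro damped_inv_unique[OF assms]) (simp only: damped_inv_eq[OF assms])
  qed
qed

lemma linear_damped_proj:
  fixes A :: "'a::euclidean_space \<Rightarrow>\<^sub>L 'b::euclidean_space"
  assumes "lam > 0"
  shows "linear (damped_proj A lam)"
  using linear_compose[OF adjoint_linear[OF linear_blinfun[of A]]
      linear_compose[OF linear_damped_inv[OF assms, of A] linear_blinfun[of A]]]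
  by (simp add: damped_proj_def[abs_def] o_def)

lemma damped_proj_orth_proj:
  "damped_proj A lam (orth_proj (range A) y) = damped_proj A lam y"
  by (simp add: damped_proj_def adjoint_orth_proj_range)

lemma damped_proj_symmetric:
  fixes A :: "'a::euclidean_space \<Rightarrow>\<^sub>L 'b::euclidean_space"
  assumes "lam > 0"
  shows "damped_proj A lam y \<bullet> w = y \<bullet> damped_proj A lam w"
proof -
  note aw = adjoint_works[OF linear_blinfun[of A]]
  have *: "damped_proj A lam y \<bullet> w
      = damped_proj A lam w \<bullet> damped_proj A lam y
        + lam * (damped_inv A lam (adjoint A w) \<bullet> damped_inv A lam (adjoint A y))" for y w
  proof -
    have "damped_proj A lam y \<bullet> w = damped_inv A lam (adjoint A y) \<bullet> adjoint A w"
      by (simp add: damped_proj_def aw)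
    also have "\<dots> = damped_inv A lam (adjoint A y) \<bullet>
        (adjoint A (A (damped_inv A lam (adjoint A w))) + lam *\<^sub>R damped_inv A lam (adjoint A w))"
      by (simp add: damped_inv_eq[OF assms])
    finally show ?thesis
      by (simp add: inner_add_right aw damped_proj_def inner_commute)
  qed
  show ?thesis using *[of y w] *[of w y] by (simp add: inner_commute)
qed

text \<open>The inner product of the normal equation \<open>(A\<^sup>T A + \<lambda>) d = A\<^sup>T y\<close> with its solution \<open>d\<close>. It
  shows at once that \<open>P\<close>, the map \<open>damped_proj A \<lambda>\<close>, satisfies \<open>P\<^sup>2 \<le> P\<close>, and it bounds \<open>d\<close>.\<close>

lemma damped_step_energy:
  fixes A :: "'a::euclidean_space \<Rightarrow>\<^sub>L 'b::euclidean_space"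
  assumes "lam > 0"
  shows "(norm (damped_proj A lam y))\<^sup>2 + lam * (norm (damped_inv A lam (adjoint A y)))\<^sup>2
    = damped_proj A lam y \<bullet> y"
proof -
  note aw = adjoint_works[OF linear_blinfun[of A]]
  let ?d = "damped_inv A lam (adjoint A y)"
  have "?d \<bullet> (adjoint A (A ?d) + lam *\<^sub>R ?d) = ?d \<bullet> adjoint A y"
    by (simp add: damped_inv_eq[OF assms])
  then show ?thesis
    by (simp add: inner_add_right aw damped_proj_def power2_norm_eq_inner)
qed

lemma norm_damped_proj_le:
  fixes A :: "'a::euclidean_space \<Rightarrow>\<^sub>L 'b::euclidean_space"
  assumes "lam > 0"
  shows "norm (damped_proj A lam y) \<le> norm y"
proof -
  have "(norm (damped_proj A lam y))\<^sup>2 \<le> damped_proj A lam y \<bullet> y"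
    using damped_step_energy[OF assms, of A y] assms
    by (smt (verit) mult_nonneg_nonneg zero_le_power2)
  also have "\<dots> \<le> norm (damped_proj A lam y) * norm y" by (rule norm_cauchy_schwarz)
  finally show ?thesis
    by (metis (no_types) mult_left_le_imp_le norm_ge_zero norm_zero order_le_less power2_eq_square zero_less_norm_iff)
qed

lemma norm_diff_damped_proj_le:
  fixes A :: "'a::euclidean_space \<Rightarrow>\<^sub>L 'b::euclidean_space"
  assumes "lam > 0"
  shows "norm (y - damped_proj A lam y) \<le> norm y"
proof -
  have "(norm (y - damped_proj A lam y))\<^sup>2
      = (norm y)\<^sup>2 - 2 * (damped_proj A lam y \<bullet> y) + (norm (damped_proj A lam y))\<^sup>2"
    by (simp add: power2_norm_eq_inner algebra_simps inner_commute)
  also have "\<dots> \<le> (norm y)\<^sup>2"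
    using damped_step_energy[OF assms, of A y] assms
    by (smt (verit) mult_nonneg_nonneg zero_le_power2)
  finally show ?thesis by (rule power2_le_imp_le) simp
qed

text \<open>The operator \<open>(A\<^sup>T A + \<lambda>)\<^sup>-\<^sup>1 A\<^sup>T\<close> has singular values \<open>\<sigma> / (\<sigma>\<^sup>2 + \<lambda>)\<close>, at most \<open>1 / (2 \<surd>\<lambda>)\<close>.
  In the proof below the energy identity leaves \<open>p (\<parallel>y\<parallel> - p)\<close> with \<open>p = \<parallel>P y\<parallel>\<close>, and the
  maximum of that parabola takes the place of the maximum over \<open>\<sigma>\<close>.\<close>

lemma norm_damped_step_le:
  fixes A :: "'a::euclidean_space \<Rightarrow>\<^sub>L 'b::euclidean_space"
  assumes "lam > 0"
  shows "lam * (norm (damped_inv A lam (adjoint A y)))\<^sup>2 \<le> (norm y)\<^sup>2 / 4"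
proof -
  let ?p = "norm (damped_proj A lam y)"
  have "lam * (norm (damped_inv A lam (adjoint A y)))\<^sup>2 \<le> ?p * norm y - ?p\<^sup>2"
    using damped_step_energy[OF assms, of A y] norm_cauchy_schwarz[of "damped_proj A lam y" y]
    by simp
  also have "\<dots> = (norm y)\<^sup>2 / 4 - (?p - norm y / 2)\<^sup>2"
    by (simp add: power2_eq_square algebra_simps)
  finally show ?thesis by (smt (verit) zero_le_power2)
qed

section \<open>Damping and the singular value decomposition\<close>

lemma svd_adjoint:
  fixes A :: "'a::euclidean_space \<Rightarrow>\<^sub>L 'b::euclidean_space"
  assumes svd: "is_svd A sig u v" and i: "i \<in> {1..min DIM('a) DIM('b)}"
  shows "A (v i) = sig i *\<^sub>R u i" and "adjoint A (u i) = sig i *\<^sub>R v i"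
proof -
  let ?r = "min DIM('a) DIM('b)"
  have uu: "u k \<bullet> u l = (if k = l then 1 else 0)"
    and vv: "v k \<bullet> v l = (if k = l then 1 else 0)"
    if "k \<in> {1..?r}" "l \<in> {1..?r}" for k l
    using svd that unfolding is_svd_def Let_def by blast+
  have Aw: "A w = (\<Sum>k=1..?r. (sig k * (v k \<bullet> w)) *\<^sub>R u k)" for w
    using svd unfolding is_svd_def Let_def by blast
  have "A (v i) = (\<Sum>k=1..?r. if k = i then sig i *\<^sub>R u i else 0)"
    unfolding Aw using i by (intro sum.cong) (auto simp: vv)
  also have "\<dots> = sig i *\<^sub>R u i" using i by (subst sum.delta) auto
  finally show "A (v i) = sig i *\<^sub>R u i" .
  have "w \<bullet> (adjoint A (u i) - sig i *\<^sub>R v i) = 0" for w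
  proof -
    have "w \<bullet> adjoint A (u i) = A w \<bullet> u i"
      by (rule adjoint_works[OF linear_blinfun])
    also have "\<dots> = (\<Sum>k=1..?r. (sig k * (v k \<bullet> w)) * (u k \<bullet> u i))"
      unfolding Aw by (simp add: inner_sum_left)
    also have "\<dots> = (\<Sum>k=1..?r. if k = i then sig i * (v i \<bullet> w) else 0)"
      using i by (intro sum.cong) (auto simp: uu)
    also have "\<dots> = sig i * (v i \<bullet> w)" using i by (subst sum.delta) auto
    finally show ?thesis by (simp add: inner_diff_right inner_commute)
  qed
  then show "adjoint A (u i) = sig i *\<^sub>R v i" by (metis inner_eq_zero_iff right_minus_eq)
qed

lemma damped_proj_singular_vector:
  fixes A :: "'a::euclidean_space \<Rightarrow>\<^sub>L 'b::euclidean_space"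
  assumes svd: "is_svd A sig u v" and i: "i \<in> {1..min DIM('a) DIM('b)}" and lam: "lam > 0"
  shows "u i - damped_proj A lam (u i) = (lam / ((sig i)\<^sup>2 + lam)) *\<^sub>R u i"
proof -
  note la = adjoint_linear[OF linear_blinfun[of A]]
  have pos: "(sig i)\<^sup>2 + lam > 0" using lam by (simp add: add_nonneg_pos)
  have "adjoint A (A (v i)) + lam *\<^sub>R v i = ((sig i)\<^sup>2 + lam) *\<^sub>R v i"
    by (simp add: svd_adjoint[OF svd i] linear_cmul[OF la] power2_eq_square scaleR_add_left)
  then have "damped_inv A lam (((sig i)\<^sup>2 + lam) *\<^sub>R v i) = v i"
    by (rule damped_inv_unique[OF lam])
  then have "damped_inv A lam (v i) = (1 / ((sig i)\<^sup>2 + lam)) *\<^sub>R v i"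
    using pos by (simp add: linear_cmul[OF linear_damped_inv[OF lam]] eq_vector_fraction_iff)
  then have "damped_proj A lam (u i) = ((sig i)\<^sup>2 / ((sig i)\<^sup>2 + lam)) *\<^sub>R u i"
    by (simp add: damped_proj_def svd_adjoint[OF svd i] linear_cmul[OF linear_damped_inv[OF lam]]
        blinfun.scaleR_right power2_eq_square)
  then have "u i - damped_proj A lam (u i) = (1 - (sig i)\<^sup>2 / ((sig i)\<^sup>2 + lam)) *\<^sub>R u i"
    by (simp add: scaleR_diff_left)
  also have "1 - (sig i)\<^sup>2 / ((sig i)\<^sup>2 + lam) = lam / ((sig i)\<^sup>2 + lam)"
    using pos by (simp add: field_simps)
  finally show ?thesis .
qed

text \<open>The left singular vectors diagonalise \<open>I - P\<close> with eigenvalues \<open>\<lambda> / (\<sigma>\<^sub>i\<^sup>2 + \<lambda>)\<close>. On the span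
  of the first \<open>j\<close> of them the largest one belongs to the smallest singular value, \<open>\<sigma>\<^sub>j\<close>.\<close>

lemma damping_error_top_span:
  fixes A :: "'a::euclidean_space \<Rightarrow>\<^sub>L 'b::euclidean_space"
  assumes svd: "is_svd A sig u v" and j: "j \<in> {1..min DIM('a) DIM('b)}" and lam: "lam > 0"
    and y: "y \<in> span (u ` {1..j})"
  shows "norm (y - damped_proj A lam y) \<le> lam / ((sig j)\<^sup>2 + lam) * norm y"
proof -
  let ?r = "min DIM('a) DIM('b)"
  let ?f = "\<lambda>i. lam / ((sig i)\<^sup>2 + lam)"
  have uu: "u k \<bullet> u l = (if k = l then 1 else 0)" if "k \<in> {1..?r}" "l \<in> {1..?r}" for k l
    using svd that unfolding is_svd_def Let_def by blast
  have nonneg: "0 \<le> sig j" and mono: "\<And>i. i \<in> {1..j} \<Longrightarrow> sig j \<le> sig i"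
    using svd j unfolding is_svd_def Let_def monotone_on_def by auto
  have inj: "inj_on u {1..j}"
  proof (rule inj_onI)
    fix k l assume kl: "k \<in> {1..j}" "l \<in> {1..j}" "u k = u l"
    then have "u k \<bullet> u l = 1" using uu[of l l] j by auto
    then show "k = l" using uu[of k l] kl j by (auto split: if_splits)
  qed
  obtain c where c: "y = (\<Sum>i=1..j. c i *\<^sub>R u i)"
  proof -
    obtain g where "y = (\<Sum>w\<in>u ` {1..j}. g w *\<^sub>R w)"
      using y by (auto simp: span_finite)
    also have "\<dots> = (\<Sum>i=1..j. g (u i) *\<^sub>R u i)"
      by (simp only: sum.reindex[OF inj] o_def)
    finally show ?thesis by (rule that)
  qed
  have sq: "(norm (\<Sum>i=1..j. b i *\<^sub>R u i))\<^sup>2 = (\<Sum>i=1..j. (b i)\<^sup>2)" for b :: "nat \<Rightarrow> real"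
  proof -
    have "(norm (\<Sum>i=1..j. b i *\<^sub>R u i))\<^sup>2
        = (\<Sum>i=1..j. \<Sum>k=1..j. b i * b k * (u i \<bullet> u k))"
      unfolding power2_norm_eq_inner inner_sum_left inner_sum_right
      by (subst sum.swap, intro sum.cong refl) simp
    also have "\<dots> = (\<Sum>i=1..j. \<Sum>k=1..j. if k = i then b i * b i else 0)"
      using j by (intro sum.cong refl) (auto simp: uu)
    also have "\<dots> = (\<Sum>i=1..j. (b i)\<^sup>2)"
      by (intro sum.cong refl, subst sum.delta) (auto simp: power2_eq_square)
    finally show ?thesis .
  qed
  note lp = linear_damped_proj[OF lam, of A]
  have "y - damped_proj A lam y = (\<Sum>i=1..j. c i *\<^sub>R (u i - damped_proj A lam (u i)))"
    unfolding c by (simp add: linear_sum[OF lp] linear_cmul[OF lp] sum_subtractf scaleR_diff_right)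
  also have "\<dots> = (\<Sum>i=1..j. (c i * ?f i) *\<^sub>R u i)"
    using j by (intro sum.cong refl) (auto simp: damped_proj_singular_vector[OF svd _ lam])
  finally have "(norm (y - damped_proj A lam y))\<^sup>2 = (\<Sum>i=1..j. (c i * ?f i)\<^sup>2)"
    by (simp only: sq)
  also have "\<dots> \<le> (\<Sum>i=1..j. (?f j)\<^sup>2 * (c i)\<^sup>2)"
  proof (rule sum_mono)
    fix i assume i: "i \<in> {1..j}"
    have "(sig j)\<^sup>2 \<le> (sig i)\<^sup>2" using mono[OF i] nonneg by (rule power_mono)
    then have "?f i \<le> ?f j" using lam by (intro divide_left_mono) (auto simp: add_nonneg_pos)
    moreover have "0 \<le> ?f i" using lam by simp
    ultimately have "(?f i)\<^sup>2 \<le> (?f j)\<^sup>2" by (rule power_mono)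
    then have "(c i)\<^sup>2 * (?f i)\<^sup>2 \<le> (c i)\<^sup>2 * (?f j)\<^sup>2" by (rule mult_left_mono) simp
    then show "(c i * ?f i)\<^sup>2 \<le> (?f j)\<^sup>2 * (c i)\<^sup>2"
      by (simp only: power_mult_distrib mult.commute)
  qed
  also have "\<dots> = (?f j * norm y)\<^sup>2"
    unfolding power_mult_distrib c sq by (simp add: sum_distrib_left)
  finally show ?thesis by (rule power2_le_imp_le[of _ "?f j * norm y"]) (use lam in auto)
qed

text \<open>Split \<open>e\<close> into its part in the top singular subspace, which is damped little because \<open>\<sigma>\<^sub>j\<close> is
  large, and the rest, which is small and which \<open>I - P\<close> does not enlarge. The lower bound on
  \<open>\<sigma>\<^sub>j\<^sup>2\<close> is proportional to \<open>\<parallel>e\<parallel>\<close>, so \<open>\<lambda> \<parallel>e\<parallel> / \<sigma>\<^sub>j\<^sup>2\<close> is bounded by the constant \<open>\<lambda> / c\<close>. The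
  bound in this form also covers \<open>e = 0\<close>.\<close>

lemma damping_error_aligned:
  fixes A :: "'a::euclidean_space \<Rightarrow>\<^sub>L 'b::euclidean_space"
  assumes svd: "is_svd A sig u v" and j: "j \<in> {1..min DIM('a) DIM('b)}" and lam: "lam > 0"
    and tail: "norm (e - orth_proj (span (u ` {1..j})) e) \<le> \<rho> * norm e"
    and top: "(sig j)\<^sup>2 \<ge> c * norm e" and c: "c > 0"
  shows "norm (e - damped_proj A lam e) \<le> \<rho> * norm e + lam / c"
proof -
  let ?p = "orth_proj (span (u ` {1..j})) e"
  have S: "subspace (span (u ` {1..j}))" by simp
  note lp = linear_damped_proj[OF lam, of A]
  have "e - damped_proj A lam e
      = (?p - damped_proj A lam ?p) + ((e - ?p) - damped_proj A lam (e - ?p))"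
    by (simp add: linear_diff[OF lp])
  then have "norm (e - damped_proj A lam e)
      \<le> norm (?p - damped_proj A lam ?p) + norm ((e - ?p) - damped_proj A lam (e - ?p))"
    by (metis norm_triangle_ineq)
  also have "norm ((e - ?p) - damped_proj A lam (e - ?p)) \<le> \<rho> * norm e"
    using norm_diff_damped_proj_le[OF lam] tail by (rule order_trans)
  also have "norm (?p - damped_proj A lam ?p) \<le> lam / c"
  proof -
    have pos: "(sig j)\<^sup>2 + lam > 0" using lam by (simp add: add_nonneg_pos)
    have "norm (?p - damped_proj A lam ?p) \<le> lam / ((sig j)\<^sup>2 + lam) * norm ?p"
      by (rule damping_error_top_span[OF svd j lam orth_proj_mem(1)[OF S]])
    also have "\<dots> \<le> lam / ((sig j)\<^sup>2 + lam) * norm e"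
      using lam by (intro mult_left_mono norm_orth_proj_le[OF S]) auto
    also have "\<dots> \<le> lam / c"
    proof -
      have "c * norm e \<le> (sig j)\<^sup>2 + lam" using top lam by simp
      then have "lam * (c * norm e) \<le> lam * ((sig j)\<^sup>2 + lam)" using lam by simp
      then show ?thesis using pos c by (simp add: field_simps)
    qed
    finally show ?thesis .
  qed
  finally show ?thesis by simp
qed

section \<open>First-order bounds\<close>

text \<open>Compare the speed of \<open>t \<mapsto> F (x + t d) - t DF(x) d\<close> with that of the quadratic
  \<open>t \<mapsto> L \<parallel>d\<parallel>\<^sup>2 t\<^sup>2 / 2\<close>. A uniform bound on the speed would lose the factor \<open>1/2\<close>,
  and with \<open>\<gamma> \<le> Clb / L\<close> the estimate for the Polyak rule would then show no gain.\<close>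

lemma lipschitz_derivative_remainder:
  fixes F :: "'a::euclidean_space \<Rightarrow> 'b::euclidean_space"
  assumes der: "\<And>x. (F has_derivative blinfun_apply (DF x)) (at x)"
    and lip: "L-lipschitz_on UNIV DF"
  shows "norm (F (x + d) - F x - DF x d) \<le> L / 2 * (norm d)\<^sup>2"
proof -
  let ?g = "\<lambda>t. F (x + t *\<^sub>R d) - t *\<^sub>R DF x d"
  let ?m = "\<lambda>t. L / 2 * (norm d)\<^sup>2 * t\<^sup>2"
  have g: "(?g has_vector_derivative (DF (x + t *\<^sub>R d) d - DF x d)) (at t)" for t
  proof -
    have "((\<lambda>t. x + t *\<^sub>R d) has_derivative (\<lambda>h. h *\<^sub>R d)) (at t)"
      by (auto intro!: derivative_eq_intros)
    from has_derivative_compose[OF this der]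
    have "((\<lambda>t. F (x + t *\<^sub>R d)) has_derivative (\<lambda>h. h *\<^sub>R DF (x + t *\<^sub>R d) d)) (at t)"
      by (simp add: blinfun.scaleR_right)
    then show ?thesis
      unfolding has_vector_derivative_def
      by (auto intro!: derivative_eq_intros simp: scaleR_diff_right)
  qed
  have m: "(?m has_vector_derivative (L * (norm d)\<^sup>2 * t)) (at t)" for t
    unfolding has_real_derivative_iff_has_vector_derivative[symmetric]
    by (auto intro!: derivative_eq_intros)
  have "norm (?g 1 - ?g 0) \<le> ?m 1 - ?m 0"
  proof (rule differentiable_bound_general[where f' = "\<lambda>t. DF (x + t *\<^sub>R d) d - DF x d"
        and \<phi>' = "\<lambda>t. L * (norm d)\<^sup>2 * t"])
    show "continuous_on {0..1} ?g"
      by (intro continuous_at_imp_continuous_on ballI has_vector_derivative_continuous[OF g])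
    show "continuous_on {0..1} ?m"
      by (intro continuous_at_imp_continuous_on ballI has_vector_derivative_continuous[OF m])
    fix t :: real assume t: "0 < t" "t < 1"
    show "(?g has_vector_derivative (DF (x + t *\<^sub>R d) d - DF x d)) (at t)" by (rule g)
    show "(?m has_vector_derivative (L * (norm d)\<^sup>2 * t)) (at t)" by (rule m)
    have "norm (DF (x + t *\<^sub>R d) d - DF x d) = norm ((DF (x + t *\<^sub>R d) - DF x) d)"
      by (simp add: blinfun.diff_left)
    also have "\<dots> \<le> norm (DF (x + t *\<^sub>R d) - DF x) * norm d" by (rule norm_blinfun)
    also have "\<dots> \<le> (L * norm (t *\<^sub>R d)) * norm d"
      using lipschitz_onD[OF lip, of "x + t *\<^sub>R d" x]
      by (intro mult_right_mono) (auto simp: dist_norm)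
    also have "\<dots> = L * (norm d)\<^sup>2 * t" using t by (simp add: power2_eq_square)
    finally show "norm (DF (x + t *\<^sub>R d) d - DF x d) \<le> L * (norm d)\<^sup>2 * t" .
  qed simp
  then show ?thesis by (simp add: algebra_simps)
qed

lemma convex_gderiv_above_tangent:
  fixes h :: "'b::euclidean_space \<Rightarrow> real"
  assumes cv: "convex_on UNIV h" and der: "GDERIV h z :> g"
  shows "h w \<ge> h z + g \<bullet> (w - z)"
proof -
  let ?f = "\<lambda>t. h (z + t *\<^sub>R (w - z))"
  have "convex_on UNIV ?f"
  proof (rule convex_onI)
    fix t a b :: real assume t: "0 < t" "t < 1"
    have "h ((1 - t) *\<^sub>R (z + a *\<^sub>R (w - z)) + t *\<^sub>R (z + b *\<^sub>R (w - z)))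
        \<le> (1 - t) * ?f a + t * ?f b"
      using convex_onD[OF cv, of t] t by simp
    moreover have "(1 - t) *\<^sub>R (z + a *\<^sub>R (w - z)) + t *\<^sub>R (z + b *\<^sub>R (w - z))
        = z + ((1 - t) *\<^sub>R a + t *\<^sub>R b) *\<^sub>R (w - z)"
      by (simp add: algebra_simps)
    ultimately show "?f ((1 - t) *\<^sub>R a + t *\<^sub>R b) \<le> (1 - t) * ?f a + t * ?f b" by simp
  qed simp
  moreover have "(?f has_real_derivative (g \<bullet> (w - z))) (at 0)"
  proof -
    have "((\<lambda>t. z + t *\<^sub>R (w - z)) has_derivative (\<lambda>k. k *\<^sub>R (w - z))) (at 0)"
      by (auto intro!: derivative_eq_intros)
    moreover have "(h has_derivative (\<lambda>k. k \<bullet> g)) (at (z + 0 *\<^sub>R (w - z)))"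
      using der by (simp add: gderiv_def)
    ultimately have "(?f has_derivative (\<lambda>k. (k *\<^sub>R (w - z)) \<bullet> g)) (at 0)"
      by (rule has_derivative_compose)
    then show ?thesis
      by (simp add: has_field_derivative_def inner_commute mult.commute[of _ "g \<bullet> (w - z)"])
  qed
  ultimately have "?f 1 - ?f 0 \<ge> (g \<bullet> (w - z)) * (1 - 0)"
    by (intro convex_on_imp_above_tangent[where A = UNIV]) auto
  then show ?thesis by simp
qed

text \<open>The step would move \<open>F x\<close> by \<open>- t P y\<close> exactly if \<open>F\<close> were affine. The error is quadratic in the
  step, whose length is at most \<open>t \<parallel>\<Pi> y\<parallel> / (2 \<surd>\<lambda>)\<close>; the damping is what keeps it under control.\<close>

lemma lmm_step_remainder:
  fixes F :: "'a::euclidean_space \<Rightarrow> 'b::euclidean_space"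
  assumes der: "\<And>x. (F has_derivative blinfun_apply (DF x)) (at x)"
    and lip: "L-lipschitz_on UNIV DF" and lam: "lam > 0"
  shows "norm (F (x - t *\<^sub>R damped_inv (DF x) lam (adjoint (DF x) y))
      - (F x - t *\<^sub>R damped_proj (DF x) lam y))
    \<le> L * t\<^sup>2 * (norm (orth_proj (range (DF x)) y))\<^sup>2 / (8 * lam)"
proof -
  let ?d = "damped_inv (DF x) lam (adjoint (DF x) y)"
  let ?G = "norm (orth_proj (range (DF x)) y)"
  have L: "L \<ge> 0" using lip by (rule lipschitz_on_nonneg)
  have "norm (F (x - t *\<^sub>R ?d) - (F x - t *\<^sub>R damped_proj (DF x) lam y))
      = norm (F (x + (- t) *\<^sub>R ?d) - F x - DF x ((- t) *\<^sub>R ?d))"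
    by (simp add: damped_proj_def blinfun.minus_right blinfun.scaleR_right algebra_simps)
  also have "\<dots> \<le> L / 2 * (norm ((- t) *\<^sub>R ?d))\<^sup>2"
    by (rule lipschitz_derivative_remainder[OF der lip])
  also have "\<dots> = L * t\<^sup>2 / (2 * lam) * (lam * (norm ?d)\<^sup>2)"
    using lam by (simp add: power_mult_distrib)
  also have "\<dots> \<le> L * t\<^sup>2 / (2 * lam) * (?G\<^sup>2 / 4)"
    using norm_damped_step_le[OF lam, of "DF x" "orth_proj (range (DF x)) y"] L lam
    by (intro mult_left_mono) (auto simp: adjoint_orth_proj_range)
  finally show ?thesis by simp
qed

lemma min_value_minimizer:
  fixes F :: "'a \<Rightarrow> 'b"
  assumes "minimizers h F = {zs}"
  shows "zs \<in> range F" and "min_value h F = h zs"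
proof -
  have am: "is_arg_min h (\<lambda>w. w \<in> range F) zs" using assms unfolding minimizers_def by blast
  then show "zs \<in> range F" by (simp add: is_arg_min_def)
  have "h zs \<le> h w" if "w \<in> range F" for w
    using am that by (auto simp: is_arg_min_linorder)
  then show "min_value h F = h zs"
    unfolding min_value_def using \<open>zs \<in> range F\<close> by (intro cInf_eq_minimum) auto
qed

section \<open>One step under regularity\<close>

text \<open>Expanding the square leaves the inner product \<open>\<langle>P g, e\<rangle> = \<langle>g, e\<rangle> - \<langle>g, (I - P) e\<rangle>\<close> with
  \<open>g = \<nabla>h(F x)\<close>. Convexity bounds \<open>\<langle>g, e\<rangle>\<close> below by the gap \<open>h(F x) - h\<^sup>\<star>\<close>, and regularity bounds
  the second term by the damping error. This is the descent estimate of the preconditioned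
  gradient method on the image of \<open>F\<close>.\<close>

lemma regular_linearized_step:
  fixes F :: "'a::euclidean_space \<Rightarrow> 'b::euclidean_space" and x :: 'a
  assumes der: "\<And>z. GDERIV h z :> gradh z"
    and reg: "smooth_regular h gradh F DF \<alpha> \<beta> zs" and lam: "lam > 0" and t: "t \<ge> 0"
  defines "e \<equiv> F x - zs"
  shows "(norm (e - t *\<^sub>R damped_proj (DF x) lam (gradh (F x))))\<^sup>2
    \<le> (norm e)\<^sup>2
      - 2 * t * (h (F x) - min_value h F - \<beta> * norm e * norm (e - damped_proj (DF x) lam e))
      + t\<^sup>2 * (norm (orth_proj (range (DF x)) (gradh (F x))))\<^sup>2"
proof -
  let ?P = "damped_proj (DF x) lam" and ?g = "gradh (F x)"
  let ?G = "norm (orth_proj (range (DF x)) ?g)"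
  have cv: "convex_on UNIV h" and mn: "minimizers h F = {zs}"
    and par: "\<bar>?g \<bullet> (e - ?P e)\<bar> \<le> \<beta> * norm e * norm (e - ?P e)"
    using reg lam unfolding smooth_regular_def e_def by blast+
  have "h zs \<ge> h (F x) + ?g \<bullet> (zs - F x)"
    by (rule convex_gderiv_above_tangent[OF cv der])
  then have "?g \<bullet> e \<ge> h (F x) - min_value h F"
    unfolding e_def min_value_minimizer(2)[OF mn] by (simp add: inner_diff_right)
  moreover have "?g \<bullet> e = ?P ?g \<bullet> e + ?g \<bullet> (e - ?P e)"
    by (simp add: damped_proj_symmetric[OF lam] inner_diff_right)
  ultimately have low: "?P ?g \<bullet> e \<ge> h (F x) - min_value h F - \<beta> * norm e * norm (e - ?P e)"
    using par by linarith
  have "norm (?P ?g) \<le> ?G"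
    using norm_damped_proj_le[OF lam, of "DF x" "orth_proj (range (DF x)) ?g"]
    by (simp only: damped_proj_orth_proj)
  then have up: "t\<^sup>2 * (norm (?P ?g))\<^sup>2 \<le> t\<^sup>2 * ?G\<^sup>2"
    by (intro mult_left_mono power_mono) auto
  have expand: "(norm (e - t *\<^sub>R p))\<^sup>2 = (norm e)\<^sup>2 - 2 * t * (p \<bullet> e) + t\<^sup>2 * (norm p)\<^sup>2" for p
    unfolding power2_norm_eq_inner
    by (simp add: inner_diff_left inner_diff_right inner_commute[of e p] algebra_simps power2_eq_square)
  have "2 * t * (?P ?g \<bullet> e)
      \<ge> 2 * t * (h (F x) - min_value h F - \<beta> * norm e * norm (e - ?P e))"
    using low t by (intro mult_left_mono) auto
  then show ?thesis using up expand[of "?P ?g"] by linarith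
qed

text \<open>The same splitting of \<open>\<langle>g, e\<rangle>\<close> as for the descent estimate, now read as an upper bound for the
  gap. It holds with any damping; \<open>\<lambda> = 1\<close> is taken. Together with quadratic growth it says
  \<open>\<alpha> \<le> 4 \<beta>\<close> unless \<open>F x\<close> is already the minimizer.\<close>

lemma regular_gap_upper:
  assumes der: "\<And>z. GDERIV h z :> gradh z"
    and reg: "smooth_regular h gradh F DF \<alpha> \<beta> zs"
  shows "h (F x) - min_value h F \<le> 2 * \<beta> * (norm (F x - zs))\<^sup>2"
proof -
  let ?e = "F x - zs" and ?P = "damped_proj (DF x) 1" and ?g = "gradh (F x)"
  have cv: "convex_on UNIV h" and mn: "minimizers h F = {zs}" and b: "\<beta> > 0"
    and grad: "norm (orth_proj (range (DF x)) ?g) \<le> \<beta> * norm ?e"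
    and par: "\<bar>?g \<bullet> (?e - ?P ?e)\<bar> \<le> \<beta> * norm ?e * norm (?e - ?P ?e)"
    using reg unfolding smooth_regular_def by (auto simp del: blinfun_apply_inject)
  have "h zs \<ge> h (F x) + ?g \<bullet> (zs - F x)"
    by (rule convex_gderiv_above_tangent[OF cv der])
  then have "h (F x) - min_value h F \<le> ?g \<bullet> ?e"
    unfolding min_value_minimizer(2)[OF mn] by (simp add: inner_diff_right)
  also have "\<dots> = ?P ?g \<bullet> ?e + ?g \<bullet> (?e - ?P ?e)"
    by (simp add: damped_proj_symmetric inner_diff_right[of ?g])
  also have "?P ?g \<bullet> ?e \<le> norm (?P ?g) * norm ?e" by (rule norm_cauchy_schwarz)
  also have "\<dots> \<le> (\<beta> * norm ?e) * norm ?e"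
    using norm_damped_proj_le[of 1 "DF x" "orth_proj (range (DF x)) ?g"] grad
    by (intro mult_right_mono) (auto simp: damped_proj_orth_proj)
  also have "?g \<bullet> (?e - ?P ?e) \<le> \<beta> * norm ?e * norm ?e"
    using par norm_diff_damped_proj_le[of 1 ?e "DF x"] b
    by (smt (verit) mult_left_mono mult_nonneg_nonneg norm_ge_zero zero_less_one)
  finally show ?thesis by (simp add: power2_eq_square)
qed

lemma weakly_aligned_damping_error:
  fixes F :: "'a::euclidean_space \<Rightarrow> 'b::euclidean_space" and DF :: "'a \<Rightarrow> 'a \<Rightarrow>\<^sub>L 'b"
  assumes svd: "is_svd (DF x) (sig x) (u x) (v x)"
    and wa: "weakly_aligned F sig u zs \<delta> s" and rho: "\<rho> > 0" and lam: "lam > 0"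
    and near: "norm (F x - zs) \<le> \<delta> \<rho>"
  shows "norm ((F x - zs) - damped_proj (DF x) lam (F x - zs)) \<le> \<rho> * norm (F x - zs) + lam / s \<rho>"
proof -
  have s: "s \<rho> > 0" using wa rho unfolding weakly_aligned_def by blast
  have "F x \<in> cball zs (\<delta> \<rho>)" using near by (simp add: dist_norm norm_minus_commute)
  then obtain j where j: "j \<in> {1..min DIM('a) DIM('b)}"
    "norm ((F x - zs) - orth_proj (span (u x ` {1..j})) (F x - zs)) \<le> \<rho> * norm (F x - zs)"
    "(sig x j)\<^sup>2 \<ge> s \<rho> * norm (F x - zs)"
    using wa rho unfolding weakly_aligned_def by blast
  show ?thesis by (rule damping_error_aligned[OF svd j(1) lam j(2,3) s])
qed

section \<open>Contraction factors of the two stepsize rules\<close>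

text \<open>Here \<open>E = \<parallel>e\<parallel>\<close>, \<open>G = \<parallel>\<Pi> g\<parallel>\<close>, \<open>D\<close> is the gap, \<open>w\<close> the damping error, and \<open>a\<close> and \<open>r\<close> are the
  norms of the linearized iterate and of the remainder. The Polyak stepsize makes both \<open>t D\<close> and
  \<open>t\<^sup>2 G\<^sup>2\<close> multiples of the single quantity \<open>T = D\<^sup>2 / G\<^sup>2\<close>: the linearized step gains
  \<open>\<gamma> T / 2\<close>, the remainder costs at most \<open>\<gamma> T / 4 + \<gamma> T / 32\<close>, and growth and smoothness give
  \<open>T \<ge> \<alpha> / (4 \<beta>) E\<^sup>2\<close>.\<close>

lemma polyak_step_arith:
  fixes E :: real
  assumes E: "E > 0" and G: "G > 0" and \<alpha>: "\<alpha> > 0" and \<beta>: "\<beta> > 0"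
    and growth: "D \<ge> \<alpha> / 2 * E\<^sup>2" and smooth: "D \<ge> 1 / (2 * \<beta>) * G\<^sup>2"
    and w: "w \<le> \<alpha> / (8 * \<beta>) * E"
    and t: "t = \<gamma> * (D / G\<^sup>2)" and \<gamma>: "0 < \<gamma>" "\<gamma> \<le> 1"
    and a: "a \<ge> 0" "a\<^sup>2 \<le> E\<^sup>2 - 2 * t * (D - \<beta> * E * w) + t\<^sup>2 * G\<^sup>2"
    and r: "r \<ge> 0" "r \<le> L * t\<^sup>2 * G\<^sup>2 / (8 * lam)"
    and C: "C > 0" "C * E \<le> lam" "\<gamma> * L \<le> C"
  shows "(a + r)\<^sup>2 \<le> (1 - \<gamma> * \<alpha> / (32 * \<beta>)) * E\<^sup>2"
proof -
  define T where "T = D\<^sup>2 / G\<^sup>2"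
  have D: "D > 0" using growth \<alpha> E by (smt (verit) mult_pos_pos zero_less_power half_gt_zero)
  have T: "T > 0" using D G by (simp add: T_def)
  have tD: "t * D = \<gamma> * T" by (simp add: t T_def power2_eq_square)
  have tG: "t\<^sup>2 * G\<^sup>2 = \<gamma>\<^sup>2 * T" using G by (simp add: t T_def power_mult_distrib power_divide power2_eq_square)
  have t0: "t > 0" using D G \<gamma> by (simp add: t)
  have "\<beta> * E * w \<le> \<beta> * E * (\<alpha> / (8 * \<beta>) * E)" using \<beta> E w by (intro mult_left_mono) auto
  also have "\<dots> = \<alpha> / 8 * E\<^sup>2" using \<beta> by (simp add: power2_eq_square)
  finally have "3 / 4 * D \<le> D - \<beta> * E * w" using growth by linarith
  then have "2 * t * (3 / 4 * D) \<le> 2 * t * (D - \<beta> * E * w)" using t0 by (intro mult_left_mono) auto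
  moreover have "2 * t * (3 / 4 * D) = 3 / 2 * (\<gamma> * T)" by (simp flip: tD)
  moreover have "\<gamma>\<^sup>2 * T \<le> \<gamma> * T" using \<gamma> T by (simp add: power2_eq_square mult_left_le)
  ultimately have a2: "a\<^sup>2 \<le> E\<^sup>2 - \<gamma> * T / 2" using a(2) tG by linarith
  have gT: "\<gamma> * T > 0" using \<gamma> T by simp
  have "a\<^sup>2 \<le> E\<^sup>2" using a2 gT by linarith
  then have aE: "a \<le> E" by (rule power2_le_imp_le) (use E in auto)
  \<comment> \<open>The square \<open>a\<^sup>2\<close> is nonnegative, so the gain \<open>\<gamma> T / 2\<close> is at most \<open>E\<^sup>2\<close>; this turns the square of
    the remainder into a fraction of \<open>\<gamma> T\<close>.\<close>
  have gTE: "\<gamma> * T \<le> 2 * E\<^sup>2" using a2 zero_le_power2[of a] by linarith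
  have lam: "lam > 0" using C(1,2) E by (smt (verit) mult_pos_pos)
  have "C * (8 * E * r) = (C * E) * (8 * r)" by simp
  also have "\<dots> \<le> lam * (8 * r)" using C r by (intro mult_right_mono) auto
  also have "\<dots> \<le> L * (\<gamma>\<^sup>2 * T)" using r(2) lam tG by (simp add: field_simps)
  also have "\<dots> = (\<gamma> * L) * (\<gamma> * T)" by (simp add: power2_eq_square)
  also have "\<dots> \<le> C * (\<gamma> * T)" using C gT by (intro mult_right_mono) auto
  finally have rE: "8 * E * r \<le> \<gamma> * T" using C by simp
  have "2 * a * r \<le> 2 * E * r" using aE r by (simp add: mult_right_mono)
  then have ar: "2 * a * r \<le> \<gamma> * T / 4" using rE by simp
  have "(8 * E * r)\<^sup>2 \<le> (\<gamma> * T)\<^sup>2" using rE E r by (intro power_mono) auto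
  also have "\<dots> \<le> (\<gamma> * T) * (2 * E\<^sup>2)"
    unfolding power2_eq_square[of "\<gamma> * T"] using gTE gT by (intro mult_left_mono) auto
  finally have "(2 * E\<^sup>2) * (32 * r\<^sup>2) \<le> (2 * E\<^sup>2) * (\<gamma> * T)" by (simp add: power_mult_distrib algebra_simps)
  then have r2: "32 * r\<^sup>2 \<le> \<gamma> * T" using E by (simp add: mult.commute[of T])
  have "\<alpha> / (4 * \<beta>) * E\<^sup>2 = 1 / (2 * \<beta>) * (\<alpha> / 2 * E\<^sup>2)" by simp
  also have "\<dots> \<le> 1 / (2 * \<beta>) * D" using growth \<beta> by (intro mult_left_mono) auto
  also have "\<dots> \<le> T"
  proof -
    have "1 / (2 * \<beta>) * G\<^sup>2 * D \<le> D * D" using smooth D by (intro mult_right_mono) auto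
    then show ?thesis using G by (simp add: T_def power2_eq_square pos_le_divide_eq mult_ac)
  qed
  finally have "\<gamma> * (\<alpha> / (4 * \<beta>) * E\<^sup>2) \<le> \<gamma> * T" using \<gamma> by (intro mult_left_mono) auto
  moreover have "\<gamma> * (\<alpha> / (4 * \<beta>) * E\<^sup>2) = 8 * (\<gamma> * \<alpha> / (32 * \<beta>) * E\<^sup>2)" by simp
  ultimately have "8 * (\<gamma> * \<alpha> / (32 * \<beta>) * E\<^sup>2) \<le> \<gamma> * T" by linarith
  moreover have "(a + r)\<^sup>2 = a\<^sup>2 + 2 * a * r + r\<^sup>2" by (simp add: power2_sum)
  moreover have "(1 - \<gamma> * \<alpha> / (32 * \<beta>)) * E\<^sup>2 = E\<^sup>2 - \<gamma> * \<alpha> / (32 * \<beta>) * E\<^sup>2"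
    by (simp add: left_diff_distrib)
  ultimately show ?thesis using a2 ar r2 gT by linarith
qed

text \<open>The notation is that of the Polyak case, and \<open>m\<close> is the bound on \<open>E\<close> that the induction
  carries. Since \<open>\<lambda>\<close> is tied to \<open>m\<close> and not to \<open>E\<close>, a step need not decrease \<open>E\<close>; only the bound
  \<open>m\<close> contracts. With \<open>p = \<gamma> \<alpha>\<close>, the second-order term and the remainder are charged to \<open>\<gamma> D\<close>, which leaves
  \<open>(1 - 19/32 p) E\<^sup>2 + p/32 m E\<close>. This increases with \<open>E\<close> because \<open>p \<le> 1/2\<close>, so \<open>E = m\<close> is the
  worst case, with the value \<open>(1 - 9/16 p) m\<^sup>2\<close>. The bound on \<open>p\<close> follows from growth and the
  upper bound on \<open>D\<close> only if \<open>E > 0\<close>; hence the separate case \<open>E = 0\<close>.\<close>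

lemma constant_step_arith:
  fixes E :: real
  assumes E: "0 \<le> E" "E \<le> m" and m: "m > 0" and \<alpha>: "\<alpha> > 0" and \<beta>: "\<beta> > 0"
    and growth: "D \<ge> \<alpha> / 2 * E\<^sup>2" and smooth: "D \<ge> 1 / (2 * \<beta>) * G\<^sup>2" and upper: "D \<le> 2 * \<beta> * E\<^sup>2"
    and w: "w \<le> \<alpha> / (16 * \<beta>) * E + lam / c"
    and c: "c > 0" and lam: "lam > 0" "lam \<le> m * c / 64 * (\<alpha> / \<beta>)"
    and \<gamma>: "0 < \<gamma>" "8 * (\<gamma> * \<beta>) \<le> 1" "2 * L * (\<gamma> * \<beta>) * m \<le> lam" and L: "L \<ge> 0"
    and a: "a \<ge> 0" "a\<^sup>2 \<le> E\<^sup>2 - 2 * \<gamma> * (D - \<beta> * E * w) + \<gamma>\<^sup>2 * G\<^sup>2"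
    and r: "r \<ge> 0" "r \<le> L * \<gamma>\<^sup>2 * G\<^sup>2 / (8 * lam)"
    and Q: "Q \<ge> 0" "Q \<ge> 1 - \<gamma> * \<alpha> / 2"
  shows "(a + r)\<^sup>2 \<le> m\<^sup>2 * Q"
proof -
  define p where "p = \<gamma> * \<alpha>"
  have p: "p > 0" using \<gamma> \<alpha> by (simp add: p_def)
  have D: "D \<ge> 0" using growth \<alpha> by (smt (verit) mult_nonneg_nonneg zero_le_power2 half_gt_zero)
  have gD: "\<gamma> * D \<ge> 0" using \<gamma> D by simp
  have gE: "\<gamma> * D \<ge> p / 2 * E\<^sup>2"
    using mult_left_mono[OF growth, of \<gamma>] \<gamma> by (simp add: p_def)
  have "\<gamma> * D \<le> \<gamma> * (2 * \<beta> * E\<^sup>2)" using upper \<gamma> by (intro mult_left_mono) auto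
  also have "\<dots> = (8 * (\<gamma> * \<beta>)) * (E\<^sup>2 / 4)" by simp
  also have "\<dots> \<le> 1 * (E\<^sup>2 / 4)" using \<gamma> by (intro mult_right_mono) auto
  finally have gDE: "\<gamma> * D \<le> E\<^sup>2 / 4" by simp
  have G2: "G\<^sup>2 \<le> 2 * \<beta> * D" using smooth \<beta> by (simp add: field_simps)
  have lc: "lam / c \<le> m * \<alpha> / (64 * \<beta>)" using lam c \<beta> by (simp add: field_simps)
  have "\<beta> * E * w \<le> \<beta> * E * (\<alpha> / (16 * \<beta>) * E + m * \<alpha> / (64 * \<beta>))"
    using \<beta> E w lc by (intro mult_left_mono) auto
  also have "\<dots> = \<alpha> / 16 * E\<^sup>2 + \<alpha> / 64 * (m * E)" using \<beta> by (simp add: field_simps power2_eq_square)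
  finally have "2 * \<gamma> * (\<beta> * E * w) \<le> 2 * \<gamma> * (\<alpha> / 16 * E\<^sup>2 + \<alpha> / 64 * (m * E))"
    using \<gamma> by (intro mult_left_mono) auto
  then have bw: "2 * \<gamma> * (\<beta> * E * w) \<le> p / 8 * E\<^sup>2 + p / 32 * (m * E)"
    by (simp add: p_def algebra_simps)
  have "\<gamma>\<^sup>2 * G\<^sup>2 \<le> \<gamma>\<^sup>2 * (2 * \<beta> * D)" using G2 by (intro mult_left_mono) auto
  also have "\<dots> = (8 * (\<gamma> * \<beta>)) * (\<gamma> * D / 4)" by (simp add: power2_eq_square)
  also have "\<dots> \<le> 1 * (\<gamma> * D / 4)" using \<gamma> gD by (intro mult_right_mono) auto
  finally have gG: "\<gamma>\<^sup>2 * G\<^sup>2 \<le> \<gamma> * D / 4" by simp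
  have "a\<^sup>2 \<le> E\<^sup>2 - 2 * (\<gamma> * D) + 2 * \<gamma> * (\<beta> * E * w) + \<gamma>\<^sup>2 * G\<^sup>2"
    using a(2) by (simp add: algebra_simps)
  then have a2: "a\<^sup>2 \<le> E\<^sup>2 - 7 / 4 * (\<gamma> * D) + p / 8 * E\<^sup>2 + p / 32 * (m * E)"
    using bw gG by linarith
  have Em: "E\<^sup>2 \<le> m\<^sup>2" "m * E \<le> m\<^sup>2"
    unfolding power2_eq_square using E m by (intro mult_mono mult_left_mono; simp)+
  have p_half: "p \<le> 1 / 2" if "E > 0"
  proof -
    have "E\<^sup>2 * p \<le> E\<^sup>2 * (1 / 2)" using gE gDE by (simp add: mult.commute)
    then show ?thesis using that by simp
  qed
  have am: "a \<le> m"
  proof -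
    have "a\<^sup>2 \<le> m\<^sup>2"
    proof (cases "E = 0")
      case True
      then have "a\<^sup>2 \<le> - (7 / 4 * (\<gamma> * D))" using a2 by simp
      then show ?thesis using gD zero_le_power2[of m] by linarith
    next
      case False
      then have "p \<le> 1 / 2" using p_half E by simp
      have "a\<^sup>2 \<le> (1 - 3 / 4 * p) * E\<^sup>2 + p / 32 * (m * E)"
        using a2 gE by (simp add: algebra_simps)
      also have "\<dots> \<le> (1 - 3 / 4 * p) * m\<^sup>2 + p / 32 * m\<^sup>2"
        using Em p \<open>p \<le> 1 / 2\<close> by (intro add_mono mult_left_mono) auto
      also have "\<dots> = m\<^sup>2 - 23 / 32 * (p * m\<^sup>2)" by (simp add: algebra_simps)
      also have "\<dots> \<le> m\<^sup>2" using p by simp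
      finally show ?thesis .
    qed
    then show ?thesis by (rule power2_le_imp_le) (use m in auto)
  qed
  have "lam * (8 * m * r) = (8 * lam * r) * m" by simp
  also have "\<dots> \<le> (L * \<gamma>\<^sup>2 * G\<^sup>2) * m"
    using r lam m by (intro mult_right_mono) (auto simp: field_simps)
  also have "\<dots> \<le> (L * \<gamma>\<^sup>2 * (2 * \<beta> * D)) * m"
    using G2 L m by (intro mult_right_mono mult_left_mono) auto
  also have "\<dots> = (2 * L * (\<gamma> * \<beta>) * m) * (\<gamma> * D)" by (simp add: power2_eq_square)
  also have "\<dots> \<le> lam * (\<gamma> * D)" using \<gamma> gD by (intro mult_right_mono) auto
  finally have rm: "8 * m * r \<le> \<gamma> * D" using lam by simp
  have ar: "2 * a * r \<le> \<gamma> * D / 4"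
    using mult_right_mono[OF am r(1)] rm by simp
  have "m * (32 * r) \<le> m * m" using rm gDE Em by (simp add: power2_eq_square)
  then have "32 * r \<le> m" using m by simp
  then have "32 * r * r \<le> m * r" using r by (intro mult_right_mono) auto
  then have r2: "256 * r\<^sup>2 \<le> \<gamma> * D" using rm by (simp add: power2_eq_square)
  have "(a + r)\<^sup>2 = a\<^sup>2 + 2 * a * r + r\<^sup>2" by (simp add: power2_sum)
  then have tot: "(a + r)\<^sup>2 \<le> E\<^sup>2 - 23 / 16 * (\<gamma> * D) + p / 8 * E\<^sup>2 + p / 32 * (m * E)"
    using a2 ar r2 gD by linarith
  show ?thesis
  proof (cases "E = 0")
    case True
    then have "(a + r)\<^sup>2 \<le> - (23 / 16 * (\<gamma> * D))" using tot by simp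
    moreover have "0 \<le> m\<^sup>2 * Q" using Q by simp
    ultimately show ?thesis using gD by linarith
  next
    case False
    then have "p \<le> 1 / 2" using p_half E by simp
    have "(a + r)\<^sup>2 \<le> (1 - 19 / 32 * p) * E\<^sup>2 + p / 32 * (m * E)"
      using tot gE by (simp add: algebra_simps)
    also have "\<dots> \<le> (1 - 19 / 32 * p) * m\<^sup>2 + p / 32 * m\<^sup>2"
      using Em p \<open>p \<le> 1 / 2\<close> by (intro add_mono mult_left_mono) auto
    also have "\<dots> = m\<^sup>2 * (1 - 9 / 16 * p)" by (simp add: algebra_simps)
    also have "\<dots> \<le> m\<^sup>2 * Q" using Q p by (intro mult_left_mono) (auto simp: p_def)
    finally show ?thesis .
  qed
qed

section \<open>Convergence of the method\<close>

theorem theorem4p5: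
  fixes h :: "'b::euclidean_space \<Rightarrow> real"
    and gradh :: "'b \<Rightarrow> 'b"
    and F :: "'a::euclidean_space \<Rightarrow> 'b"
    and DF :: "'a \<Rightarrow> 'a \<Rightarrow>\<^sub>L 'b"
    and sig :: "'a \<Rightarrow> nat \<Rightarrow> real"
    and u :: "'a \<Rightarrow> nat \<Rightarrow> 'b"
    and v :: "'a \<Rightarrow> nat \<Rightarrow> 'a"
    and L \<alpha> \<beta> :: real
    and \<delta> s :: "real \<Rightarrow> real"
    and zs :: 'b and x0 :: 'a
  assumes "convex_on UNIV h"
    and "\<And>z. GDERIV h z :> gradh z"
    and "\<And>x. (F has_derivative blinfun_apply (DF x)) (at x)"
    and "continuous_on UNIV DF"
    and "\<And>x. is_svd (DF x) (sig x) (u x) (v x)"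
    and "L-lipschitz_on UNIV DF"
    and "smooth_regular h gradh F DF \<alpha> \<beta> zs"
    and "weakly_aligned F sig u zs \<delta> s"
    and "norm (F x0 - zs) \<le> \<delta> (\<alpha> / (16 * \<beta>))"
  shows
    "(\<forall>gam lam x \<gamma> Clb Cub.
        lmm gradh F DF x0 gam lam x \<longrightarrow>
        polyak h gradh F DF \<gamma> Clb Cub gam lam x \<longrightarrow>
        \<comment> \<open>\<open>Clb / L\<close> is infinite for \<open>L = 0\<close>\<close>
        \<gamma> \<le> (if L = 0 then 1 else min 1 (Clb / L)) \<longrightarrow>
        Cub \<le> \<alpha> / (16 * \<beta>) * s (\<alpha> / (16 * \<beta>)) \<longrightarrow>
        (\<forall>k. (norm (F (x k) - zs))\<^sup>2
               \<le> (1 - \<gamma> * \<alpha> / (32 * \<beta>)) ^ k * (norm (F x0 - zs))\<^sup>2))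
     \<and>
     (\<forall>x \<gamma> lam q M.
        M = \<delta> (\<alpha> / (16 * \<beta>)) \<longrightarrow>
        \<gamma> > 0 \<longrightarrow> lam > 0 \<longrightarrow> 0 < q \<longrightarrow> q < 1 \<longrightarrow>
        lmm gradh F DF x0 (\<lambda>k. \<gamma>) (\<lambda>k. lam * q ^ k) x \<longrightarrow>
        lam \<le> M * s (\<alpha> / (16 * \<beta>)) / 64 * (\<alpha> / \<beta>) \<longrightarrow>
        \<comment> \<open>the quotients by \<open>L\<close> are infinite for \<open>L = 0\<close>\<close>
        \<gamma> \<le> 1 / \<beta> * (if L = 0 then 1 / 8
                  else min (1 / 8) (min (sqrt (32 * lam / (L * M))) (lam / (2 * L * M)))) \<longrightarrow>
        q \<ge> max (sqrt (1 - \<gamma> * \<alpha> / 2)) (1 / sqrt 2) \<longrightarrow>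
        (\<forall>k. norm (F (x k) - zs) \<le> M * q ^ k))"
proof (intro conjI allI impI)
  note der_h = assms(2) and der_F = assms(3) and svd = assms(5) and lip = assms(6)
    and reg = assms(7) and wa = assms(8) and start = assms(9)
  define \<rho> where "\<rho> = \<alpha> / (16 * \<beta>)"
  have \<alpha>: "\<alpha> > 0" and \<beta>: "\<beta> > 0" and mn: "minimizers h F = {zs}"
    and growth: "\<And>x. h (F x) - min_value h F \<ge> \<alpha> / 2 * (norm (F x - zs))\<^sup>2"
    and smooth: "\<And>x. h (F x) - min_value h F
      \<ge> 1 / (2 * \<beta>) * (norm (orth_proj (range (DF x)) (gradh (F x))))\<^sup>2"
    using reg unfolding smooth_regular_def by blast+
  have \<rho>: "\<rho> > 0" using \<alpha> \<beta> by (simp add: \<rho>_def)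
  have s: "s \<rho> > 0" and \<delta>: "\<delta> \<rho> > 0" using wa \<rho> unfolding weakly_aligned_def by blast+
  have L: "L \<ge> 0" using lip by (rule lipschitz_on_nonneg)
  have damping: "norm ((F x - zs) - damped_proj (DF x) lam (F x - zs))
      \<le> \<alpha> / (16 * \<beta>) * norm (F x - zs) + lam / s \<rho>"
    if "lam > 0" "norm (F x - zs) \<le> \<delta> \<rho>" for x lam
    using weakly_aligned_damping_error[where F = F and DF = DF and sig = sig and u = u and v = v and x = x, OF svd wa \<rho> that] by (simp add: \<rho>_def)
  let ?lin = "\<lambda>x lam t. (F x - zs) - t *\<^sub>R damped_proj (DF x) lam (gradh (F x))"
  let ?next = "\<lambda>x lam t. x - t *\<^sub>R damped_inv (DF x) lam (adjoint (DF x) (gradh (F x)))"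
  let ?rem = "\<lambda>x lam t. F (?next x lam t) - (F x - t *\<^sub>R damped_proj (DF x) lam (gradh (F x)))"
  have split: "(norm (F (?next x lam t) - zs))\<^sup>2
      \<le> (norm (?lin x lam t) + norm (?rem x lam t))\<^sup>2" for x lam t
  proof -
    have "F (?next x lam t) - zs = ?lin x lam t + ?rem x lam t" by simp
    then have "norm (F (?next x lam t) - zs) \<le> norm (?lin x lam t) + norm (?rem x lam t)"
      by (metis norm_triangle_ineq)
    then show ?thesis by (intro power_mono) auto
  qed
  {
    fix gam lam :: "nat \<Rightarrow> real" and x :: "nat \<Rightarrow> 'a" and \<gamma> Clb Cub :: real and k :: nat
    assume lmm: "lmm gradh F DF x0 gam lam x"
      and pol: "polyak h gradh F DF \<gamma> Clb Cub gam lam x"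
      and \<gamma>_le: "\<gamma> \<le> (if L = 0 then 1 else min 1 (Clb / L))"
      and Cub: "Cub \<le> \<alpha> / (16 * \<beta>) * s (\<alpha> / (16 * \<beta>))"
    let ?c = "1 - \<gamma> * \<alpha> / (32 * \<beta>)" and ?E = "\<lambda>k. norm (F (x k) - zs)"
    have \<gamma>: "\<gamma> > 0" "\<gamma> \<le> 1" and C: "Clb > 0"
      using pol \<gamma>_le unfolding polyak_def by (auto split: if_splits)
    have \<gamma>L: "\<gamma> * L \<le> Clb" using \<gamma>_le L C by (auto simp: field_simps split: if_splits)
    have step: "?E k > 0 \<and> (?E (Suc k))\<^sup>2 \<le> ?c * (?E k)\<^sup>2" if near: "?E k \<le> \<delta> \<rho>" for k
    proof -
      let ?G = "norm (orth_proj (range (DF (x k))) (gradh (F (x k))))"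
      have gam: "gam k > 0" and lam: "lam k > 0" and nxt: "x (Suc k) = ?next (x k) (lam k) (gam k)"
        using lmm unfolding lmm_def by auto
      have gam_eq: "gam k = \<gamma> * ((h (F (x k)) - min_value h F) / ?G\<^sup>2)"
        and lb: "Clb * ?E k \<le> lam k" and ub: "lam k \<le> Cub * ?E k"
        using pol unfolding polyak_def mn by (auto simp: dist_norm)
      \<comment> \<open>Positive \<open>\<lambda>\<^sub>k\<close> and \<open>\<gamma>\<^sub>k\<close> rule out \<open>z\<^sub>k = z\<^sup>\<star>\<close> and, as division by \<open>0\<close> gives \<open>0\<close>, a vanishing
        projected gradient.\<close>
      have E: "?E k > 0" using lam ub by (cases "F (x k) = zs") auto
      have G: "?G > 0" using gam gam_eq by (cases "?G = 0") auto
      have "lam k \<le> (\<rho> * s \<rho>) * ?E k"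
        using ub Cub mult_right_mono[of Cub "\<rho> * s \<rho>" "?E k"] by (simp add: \<rho>_def)
      then have "lam k / s \<rho> \<le> \<rho> * ?E k" using s by (simp add: field_simps)
      with damping[OF lam near]
      have "norm ((F (x k) - zs) - damped_proj (DF (x k)) (lam k) (F (x k) - zs)) \<le> \<alpha> / (8 * \<beta>) * ?E k"
        by (simp add: \<rho>_def)
      from polyak_step_arith[OF E G \<alpha> \<beta> growth smooth this gam_eq \<gamma> norm_ge_zero
          regular_linearized_step[OF der_h reg lam order_less_imp_le[OF gam]] norm_ge_zero
          lmm_step_remainder[OF der_F lip lam] C lb \<gamma>L] E
      show ?thesis using split[where x = "x k" and lam = "lam k" and t = "gam k"] unfolding nxt by linarith
    qed
    have c1: "?c \<le> 1" using \<gamma> \<alpha> \<beta> by simp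
    have "?E k \<le> \<delta> \<rho> \<and> (?E k)\<^sup>2 \<le> ?c ^ k * (norm (F x0 - zs))\<^sup>2"
    proof (induction k)
      case 0
      then show ?case using start lmm by (simp add: \<rho>_def lmm_def)
    next
      case (Suc k)
      then have E: "?E k > 0" and st: "(?E (Suc k))\<^sup>2 \<le> ?c * (?E k)\<^sup>2" using step by auto
      \<comment> \<open>The factor is nonnegative because it bounds the ratio of two squares.\<close>
      have "0 \<le> ?c * (?E k)\<^sup>2" using st by (smt (verit) zero_le_power2)
      then have c0: "?c \<ge> 0" using E by (simp only: zero_le_mult_iff) (smt (verit) zero_less_power)
      have "?c * (?E k)\<^sup>2 \<le> 1 * (?E k)\<^sup>2" using c1 by (rule mult_right_mono) simp
      then have "(?E (Suc k))\<^sup>2 \<le> (?E k)\<^sup>2" using st by linarith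
      then have "?E (Suc k) \<le> ?E k" by (rule power2_le_imp_le) simp
      moreover have "?c * (?E k)\<^sup>2 \<le> ?c * (?c ^ k * (norm (F x0 - zs))\<^sup>2)"
        using Suc c0 by (intro mult_left_mono) auto
      ultimately show ?case using Suc st by simp
    qed
    then show "(?E k)\<^sup>2 \<le> ?c ^ k * (norm (F x0 - zs))\<^sup>2" by blast
  }
  {
    fix x :: "nat \<Rightarrow> 'a" and \<gamma> lam q M :: real and k :: nat
    assume M: "M = \<delta> (\<alpha> / (16 * \<beta>))" and \<gamma>: "\<gamma> > 0" and lam: "lam > 0" and q: "0 < q" "q < 1"
      and lmm: "lmm gradh F DF x0 (\<lambda>k. \<gamma>) (\<lambda>k. lam * q ^ k) x"
      and lam_le: "lam \<le> M * s (\<alpha> / (16 * \<beta>)) / 64 * (\<alpha> / \<beta>)"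
      and \<gamma>_le: "\<gamma> \<le> 1 / \<beta> * (if L = 0 then 1 / 8
                  else min (1 / 8) (min (sqrt (32 * lam / (L * M))) (lam / (2 * L * M))))"
      and q_ge: "q \<ge> max (sqrt (1 - \<gamma> * \<alpha> / 2)) (1 / sqrt 2)"
    let ?E = "\<lambda>k. norm (F (x k) - zs)"
    have M0: "M > 0" using \<delta> by (simp add: M \<rho>_def)
    have "\<gamma> * \<beta> \<le> (if L = 0 then 1 / 8
                  else min (1 / 8) (min (sqrt (32 * lam / (L * M))) (lam / (2 * L * M))))"
      using mult_left_mono[OF \<gamma>_le, of \<beta>] \<beta> by (simp add: mult.commute)
    then have \<gamma>\<beta>: "8 * (\<gamma> * \<beta>) \<le> 1" and "L \<noteq> 0 \<Longrightarrow> \<gamma> * \<beta> \<le> lam / (2 * L * M)"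
      by (auto split: if_splits)
    then have \<gamma>L: "2 * L * (\<gamma> * \<beta>) * M \<le> lam"
      using L M0 lam by (cases "L = 0") (auto simp: pos_le_divide_eq mult_ac)
    have Q: "1 - \<gamma> * \<alpha> / 2 \<le> q\<^sup>2" using q_ge q by (simp add: real_sqrt_le_iff' sqrt_le_D)
    show "?E k \<le> M * q ^ k"
    proof (induction k)
      case 0
      then show ?case using start lmm by (simp add: M lmm_def)
    next
      case (Suc k)
      let ?m = "M * q ^ k" and ?l = "lam * q ^ k"
      have qk: "q ^ k > 0" "q ^ k \<le> 1" using q by (auto intro: power_le_one)
      have m: "?m > 0" and l: "?l > 0" using M0 lam qk by auto
      have "?m \<le> M" using qk M0 by simp
      then have near: "?E k \<le> \<delta> \<rho>" using Suc by (simp add: M \<rho>_def)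
      have nxt: "x (Suc k) = ?next (x k) ?l \<gamma>" using lmm unfolding lmm_def by auto
      have l_le: "?l \<le> ?m * s \<rho> / 64 * (\<alpha> / \<beta>)"
        using mult_right_mono[OF lam_le, of "q ^ k"] qk by (simp add: \<rho>_def mult_ac)
      have lL: "2 * L * (\<gamma> * \<beta>) * ?m \<le> ?l"
        using mult_right_mono[OF \<gamma>L, of "q ^ k"] qk by (simp add: mult_ac)
      from constant_step_arith[OF norm_ge_zero Suc m \<alpha> \<beta> growth smooth
          regular_gap_upper[OF der_h reg] damping[OF l near] s l l_le \<gamma> \<gamma>\<beta> lL L norm_ge_zero
          regular_linearized_step[OF der_h reg l order_less_imp_le[OF \<gamma>]] norm_ge_zero
          lmm_step_remainder[OF der_F lip l] zero_le_power2 Q]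
      have "(?E (Suc k))\<^sup>2 \<le> ?m\<^sup>2 * q\<^sup>2"
        using split[where x = "x k" and lam = ?l and t = \<gamma>] unfolding nxt by linarith
      then have "(?E (Suc k))\<^sup>2 \<le> (M * q ^ Suc k)\<^sup>2" by (simp add: power_mult_distrib mult_ac)
      then show ?case by (rule power2_le_imp_le) (use M0 q in auto)
    qed
  }
qed

end
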